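(* Let $X\neq\{0\}$ be a real Hilbert space, let $m\in\{2,3,\ldots\}$, let $R\colon X\to X$ be a linear isometry with $R^m=\operatorname{Id}$, let $M:=\operatorname{Id}-R$, let $D:=\ker M=\{x\in X: Rx=x\}$, and let $$T:=\frac{1}{2m}\sum_{k=1}^{m-1}(m-2k)R^k.$$ Then, as set-valued operators on $X$, $$M^{-1}=\tfrac12\operatorname{Id}+T+N_{D^\perp},$$ where $N_{D^\perp}=\partial\iota_{D^\perp}$ denotes the normal cone operator of $D^\perp$.
   Context: $\operatorname{Id}$ is the identity operator on $X$. $M^{-1}$ is the set-valued inverse: $M^{-1}y=\{x\in X: Mx=y\}$ for $y\in X$ (empty if $y\notin\operatorname{ran}M$). $D^\perp$ is the orthogonal complement of $D$. The function $\iota_{D^\perp}$ is the indicator function of $D^\perp$ ($0$ on $D^\perp$, $+\infty$ elsewhere), and its subdifferential is the normal cone operator; since $D^\perp$ is a closed linear subspace and $D$ is closed, $N_{D^\perp}(y)=D$ if $y\in D^\perp$ and $N_{D^\perp}(y)=\varnothing$ otherwise. Sums of set-valued operators are pointwise Minkowski sums (empty if any summand is empty). *)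

theory Defs
  imports "HOL-Analysis.Analysis"
begin

text \<open>A set-valued operator on \<open>X\<close> is a function \<open>X \<Rightarrow> X set\<close>. For sets, \<open>+\<close> is the
  Minkowski sum of \<open>HOL-Library.Set_Algebras\<close>, which is empty if a summand is empty.\<close>

definition set_valued_inverse :: "('a \<Rightarrow> 'b) \<Rightarrow> 'b \<Rightarrow> 'a set" where
  "set_valued_inverse M y = {x. M x = y}"

definition indicator_fun :: "'a set \<Rightarrow> 'a \<Rightarrow> ereal" where
  "indicator_fun C x = (if x \<in> C then 0 else \<infinity>)"

text \<open>The subdifferential in the sense of convex analysis, for proper functions. No \<open>\<infinity> - \<infinity>\<close>
  occurs since the inner product is finite, and \<open>subdifferential f x\<close> is empty where
  \<open>f x = \<infinity>\<close>, because \<open>f\<close> is finite somewhere.\<close>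

definition subdifferential :: "('a::real_inner \<Rightarrow> ereal) \<Rightarrow> 'a \<Rightarrow> 'a set" where
  "subdifferential f x = {u. \<forall>z. ereal (inner u (z - x)) + f x \<le> f z}"

definition normal_cone :: "'a::real_inner set \<Rightarrow> 'a \<Rightarrow> 'a set" where
  "normal_cone C = subdifferential (indicator_fun C)"

end

theory Submission
  imports Defs
begin

text \<open>
  Let \<open>P\<close> be the average of the powers \<open>R\<^sup>0, \<dots>, R\<^bsup>m-1\<^esup>\<close> of \<open>R\<close>. Because \<open>R\<^sup>m = Id\<close>, applying \<open>R\<close> only
  permutes these powers cyclically, so \<open>P\<close> takes values in \<open>D = ker M\<close>; because \<open>R\<close> preserves
  inner products and fixes \<open>D\<close> pointwise, the vector \<open>x - P x\<close> is orthogonal to \<open>D\<close>. Hence \<open>P\<close> is the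
  orthogonal projection onto \<open>D\<close>. Splitting vectors with \<open>P\<close> gives \<open>D\<^sup>\<bottom>\<^sup>\<bottom> = D\<close>, so that
  the normal cone of \<open>D\<^sup>\<bottom>\<close> is \<open>D\<close> at the points of \<open>D\<^sup>\<bottom>\<close> and empty elsewhere.

  The summand \<open>Id/2\<close> supplies the term \<open>k = 0\<close> missing from \<open>T\<close>: the operator
  \<open>S = Id/2 + T\<close> is the sum over all \<open>k < m\<close> of \<open>(m - 2k)/(2m) R\<^sup>k\<close>. The weights decrease in equal steps, so summation by parts yields
  \<open>M S = Id - P\<close>. On \<open>D\<^sup>\<bottom>\<close> the projection vanishes, so \<open>S y\<close> is one solution of \<open>M x = y\<close>, and
  the full solution set is the coset \<open>S y + ker M = S y + D\<close>. Outside \<open>D\<^sup>\<bottom>\<close> both sides are empty,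
  because the range of \<open>M\<close> is orthogonal to \<open>D\<close>.
\<close>

lemma normal_cone_subspace:
  fixes C :: "'a::real_inner set"
  assumes "subspace C"
  shows "normal_cone C y = (if y \<in> C then orthogonal_comp C else {})"
proof (cases "y \<in> C")
  case True
  have "u \<in> normal_cone C y \<longleftrightarrow> (\<forall>z\<in>C. inner u (z - y) \<le> 0)" for u
    using True by (auto simp: normal_cone_def subdifferential_def indicator_fun_def zero_ereal_def)
  moreover have "(\<forall>z\<in>C. inner u (z - y) \<le> 0) \<longleftrightarrow> u \<in> orthogonal_comp C" for u
  proof
    assume u: "\<forall>z\<in>C. inner u (z - y) \<le> 0"
    have "inner u c = 0" if "c \<in> C" for c
    proof -
      \<comment> \<open>Moving from \<open>y\<close> in the directions \<open>c\<close> and \<open>-c\<close> stays in the subspace.\<close>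
      have "y + c \<in> C" "y - c \<in> C"
        using assms True that by (auto intro: subspace_add subspace_diff)
      then have "inner u ((y + c) - y) \<le> 0" "inner u ((y - c) - y) \<le> 0"
        using u by blast+
      then show ?thesis by simp
    qed
    then show "u \<in> orthogonal_comp C"
      by (simp add: orthogonal_comp_def orthogonal_def inner_commute)
  next
    assume "u \<in> orthogonal_comp C"
    moreover have "z - y \<in> C" if "z \<in> C" for z
      using assms True that by (rule_tac subspace_diff)
    ultimately show "\<forall>z\<in>C. inner u (z - y) \<le> 0"
      by (auto simp: orthogonal_comp_def orthogonal_def inner_commute[of u])
  qed
  ultimately show ?thesis using True by auto
next
  case False
  \<comment> \<open>The subgradient inequality at \<open>z = 0\<close> would read \<open>\<infinity> \<le> 0\<close>.\<close>
  have "\<not> (ereal (inner u (0 - y)) + indicator_fun C y \<le> indicator_fun C 0)" for u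
    using False subspace_0[OF assms] by (simp add: indicator_fun_def)
  then have "u \<notin> normal_cone C y" for u
    unfolding normal_cone_def subdifferential_def by blast
  then show ?thesis using False by auto
qed

text \<open>The inclusion \<open>D\<^sup>\<bottom>\<^sup>\<bottom> \<subseteq> D\<close> holds as soon as every vector splits along \<open>D\<close> and \<open>D\<^sup>\<bottom>\<close>: the
  component of \<open>u \<in> D\<^sup>\<bottom>\<^sup>\<bottom>\<close> in \<open>D\<^sup>\<bottom>\<close> is orthogonal to itself.\<close>

lemma orthogonal_comp_orthogonal_comp:
  assumes P: "\<And>x. P x \<in> D" "\<And>x. x - P x \<in> orthogonal_comp D"
  shows "orthogonal_comp (orthogonal_comp D) = D"
proof
  show "orthogonal_comp (orthogonal_comp D) \<subseteq> D"
  proof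
    fix u assume u: "u \<in> orthogonal_comp (orthogonal_comp D)"
    have "inner (u - P u) u = 0" "inner (u - P u) (P u) = 0"
      using u P[of u] unfolding orthogonal_comp_def orthogonal_def
      by (blast, auto simp: inner_commute)
    then have "inner (u - P u) (u - P u) = 0"
      by (simp add: inner_diff_right)
    then show "u \<in> D" using P(1)[of u] by simp
  qed
  show "D \<subseteq> orthogonal_comp (orthogonal_comp D)"
    by (auto simp: orthogonal_comp_def orthogonal_def inner_commute)
qed

text \<open>For \<open>a k = R\<^sup>k x\<close> and \<open>c = n = m\<close>, the left-hand side is a multiple of \<open>M\<close> applied to \<open>x/2 + T x\<close>. The
  weights have the constant difference \<open>2\<close>, so summation by parts leaves, besides boundary
  terms, only a multiple of the average of the \<open>a k\<close>.\<close>

lemma sum_arithmetic_weights_by_parts: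
  fixes a :: "nat \<Rightarrow> 'a::real_vector"
  shows "(\<Sum>k<n. (c - 2 * real k) *\<^sub>R (a k - a (Suc k)))
    = (c + 2) *\<^sub>R a 0 - (c - 2 * real n + 2) *\<^sub>R a n - 2 *\<^sub>R (\<Sum>k<n. a k)"
  by (induction n) (simp_all add: algebra_simps)

lemma linear_isometry_inner:
  fixes R :: "'a::real_inner \<Rightarrow> 'b::real_inner"
  assumes "linear R" and "\<And>x. norm (R x) = norm x"
  shows "inner (R x) (R y) = inner x y"
  using assms(2)[of "x + y"] assms(2)[of x] assms(2)[of y]
  by (simp add: linear_add[OF assms(1)] dot_norm)

definition power_average :: "('a \<Rightarrow> 'a) \<Rightarrow> nat \<Rightarrow> 'a \<Rightarrow> 'a::real_vector" where
  "power_average R m x = (1 / real m) *\<^sub>R (\<Sum>k<m. (R ^^ k) x)"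

lemma power_average_fixed:
  assumes "linear R" and "R ^^ m = id"
  shows "R (power_average R m x) = power_average R m x"
proof -
  have "(\<Sum>k<m. R ((R ^^ k) x)) - (\<Sum>k<m. (R ^^ k) x)
      = (\<Sum>k<m. (R ^^ Suc k) x - (R ^^ k) x)"
    by (simp add: sum_subtractf)
  also have "\<dots> = 0"
    by (subst sum_lessThan_telescope) (simp add: assms(2))
  finally show ?thesis
    by (simp add: power_average_def linear_cmul[OF assms(1)] linear_sum[OF assms(1)])
qed

text \<open>Against a fixed vector \<open>d\<close>, all powers \<open>R\<^sup>k x\<close> have the inner product that \<open>x\<close> has, and so
  does their average.\<close>

lemma diff_power_average_orthogonal:
  assumes "linear R" and "\<And>x. norm (R x) = norm x" and "m > 0"
  shows "x - power_average R m x \<in> orthogonal_comp {d. R d = d}"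
proof -
  have "inner d (x - power_average R m x) = 0" if "R d = d" for d
  proof -
    have "inner d ((R ^^ k) x) = inner d x" for k
    proof (induction k)
      case (Suc k)
      have "inner d ((R ^^ Suc k) x) = inner (R d) (R ((R ^^ k) x))"
        using that by simp
      also have "\<dots> = inner d ((R ^^ k) x)"
        by (rule linear_isometry_inner[OF assms(1,2)])
      finally show ?case using Suc by simp
    qed simp
    then show ?thesis
      using assms(3) by (simp add: power_average_def inner_diff_right inner_sum_right)
  qed
  then show ?thesis by (simp add: orthogonal_comp_def orthogonal_def)
qed

theorem theorem3p3:
  fixes R M T :: "'a::{real_inner, complete_space} \<Rightarrow> 'a"
    and D :: "'a set"
    and m :: nat
  assumes X_nontrivial: "(UNIV :: 'a set) \<noteq> {0}"
    and m: "m \<ge> 2"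
    and R_linear: "linear R"
    and R_isometry: "\<And>x. norm (R x) = norm x"
    and R_power: "R ^^ m = id"
  defines "M \<equiv> (\<lambda>x. x - R x)"
    and "D \<equiv> {x. M x = 0}"
    and "T \<equiv> (\<lambda>x. (1 / (2 * real m)) *\<^sub>R
                   (\<Sum>k=1..m-1. (real m - 2 * real k) *\<^sub>R (R ^^ k) x))"
  shows "set_valued_inverse M =
    (\<lambda>y. {(1/2) *\<^sub>R y} + {T y} + normal_cone (orthogonal_comp D) y)"
proof
  fix y
  define P where "P = power_average R m"
  define S where "S = (\<lambda>x. (1/2) *\<^sub>R x + T x)"
  have m_pos: "m > 0" using m by simp
  have D_fixed: "D = {d. R d = d}"
    by (auto simp: D_def M_def)
  have PD: "P x \<in> D" for x
    by (simp add: P_def D_fixed power_average_fixed[OF R_linear R_power])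
  have P_perp: "x - P x \<in> orthogonal_comp D" for x
    unfolding P_def D_fixed
    by (rule diff_power_average_orthogonal[OF R_linear R_isometry m_pos])
  have cone: "normal_cone (orthogonal_comp D) y = (if y \<in> orthogonal_comp D then D else {})"
    by (simp add: normal_cone_subspace subspace_orthogonal_comp
        orthogonal_comp_orthogonal_comp[of P, OF PD P_perp])
  have M_diff: "M (u - v) = M u - M v" for u v
    by (simp add: M_def linear_diff[OF R_linear])

  have S_sum: "S x = (1 / (2 * real m)) *\<^sub>R (\<Sum>k<m. (real m - 2 * real k) *\<^sub>R (R ^^ k) x)" for x
  proof -
    have "{..<m} = insert 0 {1..m-1}" using m_pos by auto
    then have "(\<Sum>k<m. (real m - 2 * real k) *\<^sub>R (R ^^ k) x)
        = real m *\<^sub>R x + (\<Sum>k=1..m-1. (real m - 2 * real k) *\<^sub>R (R ^^ k) x)"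
      by simp
    then show ?thesis
      using m_pos by (simp add: S_def T_def scaleR_add_right)
  qed
  have MS: "M (S x) = x - P x" for x
  proof -
    have "M (S x) = (1 / (2 * real m)) *\<^sub>R
        (\<Sum>k<m. (real m - 2 * real k) *\<^sub>R ((R ^^ k) x - (R ^^ Suc k) x))"
      by (simp add: M_def S_sum linear_cmul[OF R_linear] linear_sum[OF R_linear]
          scaleR_diff_right sum_subtractf)
    also have "\<dots> = (1 / (2 * real m)) *\<^sub>R ((2 * real m) *\<^sub>R x - 2 *\<^sub>R (\<Sum>k<m. (R ^^ k) x))"
      using sum_arithmetic_weights_by_parts[of "real m" "\<lambda>k. (R ^^ k) x" m]
      by (simp add: R_power flip: scaleR_diff_left)
    also have "\<dots> = x - P x"
      using m_pos by (simp add: P_def power_average_def scaleR_diff_right)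
    finally show ?thesis .
  qed

  have M_perp: "M x \<in> orthogonal_comp D" for x
  proof -
    have "inner d (M x) = 0" if "R d = d" for d
      using linear_isometry_inner[OF R_linear R_isometry, of d x] that
      by (simp add: M_def inner_diff_right)
    then show ?thesis by (simp add: orthogonal_comp_def orthogonal_def D_fixed)
  qed

  show "set_valued_inverse M y = {(1/2) *\<^sub>R y} + {T y} + normal_cone (orthogonal_comp D) y"
  proof (cases "y \<in> orthogonal_comp D")
    case True
    have "inner (P y) y = 0" "inner (P y) (y - P y) = 0"
      using True P_perp[of y] PD[of y] by (auto simp: orthogonal_comp_def orthogonal_def)
    then have "P y = 0" by (simp add: inner_diff_right)
    then have MSy: "M (S y) = y" by (simp add: MS)
    have "set_valued_inverse M y = {S y} + D"
    proof (intro set_eqI iffI)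
      fix x assume "x \<in> set_valued_inverse M y"
      then have "x - S y \<in> D"
        by (simp add: set_valued_inverse_def D_def M_diff MSy)
      then have "S y + (x - S y) \<in> {S y} + D"
        by (intro set_plus_intro) simp_all
      then show "x \<in> {S y} + D" by simp
    next
      fix x assume "x \<in> {S y} + D"
      then obtain d where "d \<in> D" "x = S y + d"
        by (auto elim: set_plus_elim)
      then have "M (x - S y) = 0" by (simp add: D_def)
      then show "x \<in> set_valued_inverse M y"
        by (simp add: set_valued_inverse_def M_diff MSy)
    qed
    then show ?thesis
      using True by (simp add: cone S_def set_plus_def)
  next
    case False
    then have "set_valued_inverse M y = {}"
      using M_perp by (auto simp: set_valued_inverse_def)
    then show ?thesis
      using False by (simp add: cone set_plus_def)
  qed
qed

end
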